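(* Let $Q$ be a subset of $\mathbb{Q}_{>0} \setminus \mathbb{N}$ such that $2 \le |Q| < \infty$ and $\gcd(\mathsf{d}(Q)) = 1$. Then the monoid $M_Q = \langle q^n : (q,n) \in Q \times \mathbb{N}_0 \rangle$ powerly generated by $Q$ is a finite factorization monoid (FFM) if and only if $q \ge 1$ for all $q \in Q$.
   Context: $\langle S \rangle$ denotes the additive submonoid of $\mathbb{Q}_{\ge 0}$ generated by $S$. For a positive rational $q$, $\mathsf{d}(q)$ denotes its denominator in lowest terms, and $\mathsf{d}(Q) = \{\mathsf{d}(q) : q \in Q\}$. An atom of $M_Q$ is an element $a \in M_Q \setminus \{0\}$ such that $a = b+c$ with $b,c \in M_Q$ implies $b=0$ or $c=0$. A monoid $M \subseteq \mathbb{Q}_{\ge 0}$ is atomic if every nonzero element is a finite sum of atoms (repetitions allowed). A factorization of $b \in M$ is a finite formal sum (multiset) of atoms of $M$ whose sum is $b$. $M$ is an FFM if it is atomic and every element of $M$ has only finitely many factorizations. Here $\mathbb{N} = \{1,2,\dots\}$ and $\mathbb{N}_0 = \mathbb{N}\cup\{0\}$. *)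

theory Defs
  imports Complex_Main "HOL-Library.Multiset"
begin

definition denominator :: "rat \<Rightarrow> int" where
  "denominator q = snd (quotient_of q)"

definition add_submonoid :: "rat set \<Rightarrow> bool" where
  "add_submonoid M \<longleftrightarrow> 0 \<in> M \<and> (\<forall>x\<in>M. \<forall>y\<in>M. x + y \<in> M)"

text \<open>The closure is taken in all of the rationals; if \<open>S\<close> consists of nonnegative numbers,
  the result is the same as the closure taken inside the nonnegative rationals.\<close>
definition generated_monoid :: "rat set \<Rightarrow> rat set" where
  "generated_monoid S = add_submonoid hull S"

definition powerly_generated_monoid :: "rat set \<Rightarrow> rat set" where
  "powerly_generated_monoid Q = generated_monoid {q ^ n | q n. q \<in> Q}"

text \<open>The definitions of atoms and of what builds on them are meant for \<open>M\<close> a monoid of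
  nonnegative rationals, in which 0 is the only invertible element.\<close>
definition atoms :: "rat set \<Rightarrow> rat set" where
  "atoms M = {a \<in> M - {0}. \<forall>b\<in>M. \<forall>c\<in>M. a = b + c \<longrightarrow> b = 0 \<or> c = 0}"

definition factorizations :: "rat set \<Rightarrow> rat \<Rightarrow> rat multiset set" where
  "factorizations M b = {F. set_mset F \<subseteq> atoms M \<and> sum_mset F = b}"

definition atomic_monoid :: "rat set \<Rightarrow> bool" where
  "atomic_monoid M \<longleftrightarrow> (\<forall>b \<in> M - {0}. factorizations M b \<noteq> {})"

definition finite_factorization_monoid :: "rat set \<Rightarrow> bool" where
  "finite_factorization_monoid M \<longleftrightarrow>
     atomic_monoid M \<and> (\<forall>b\<in>M. finite (factorizations M b))"

end

theory Submission
  imports Defs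
begin

text \<open>If some \<open>q = a/b \<in> Q\<close> is less than 1, then telescoping
  \<open>a q\<^sup>i - a q\<^sup>i\<^sup>+\<^sup>1 = (b - a) q\<^sup>i\<^sup>+\<^sup>1\<close> writes \<open>a\<close> as a sum of arbitrarily many nonzero elements of \<open>M\<^sub>Q\<close>,
  so if \<open>M\<^sub>Q\<close> is atomic then \<open>a\<close> has factorizations of unbounded length. Conversely, if every
  \<open>q\<close> exceeds 1, then nonzero elements are at least 1 and only finitely many generators lie
  below a given bound, which bounds both the length and the support of a factorization.\<close>

lemma add_submonoid_generated: "add_submonoid (generated_monoid S)"
  unfolding generated_monoid_def by (rule hull_in) (auto simp: add_submonoid_def)

lemma generators_subset: "S \<subseteq> generated_monoid S"
  unfolding generated_monoid_def by (rule hull_subset)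

lemma generated_minimal: "S \<subseteq> N \<Longrightarrow> add_submonoid N \<Longrightarrow> generated_monoid S \<subseteq> N"
  unfolding generated_monoid_def by (rule hull_minimal)

lemma add_submonoid_of_nat_mult:
  "add_submonoid M \<Longrightarrow> x \<in> M \<Longrightarrow> of_nat n * x \<in> M"
  by (induction n) (auto simp: add_submonoid_def algebra_simps)

lemma factorizations_add:
  "F \<in> factorizations M x \<Longrightarrow> G \<in> factorizations M y \<Longrightarrow> F + G \<in> factorizations M (x + y)"
  by (auto simp: factorizations_def)

text \<open>The empty multiset sums to 0, so a factorization of a nonzero element contains at least
  one atom. This makes each nonzero telescoping term contribute to the length.\<close>

lemma ex_nonempty_factorization:
  assumes "atomic_monoid M" "x \<in> M" "x \<noteq> 0"
  obtains F where "F \<in> factorizations M x" "size F \<ge> 1"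
proof -
  from assms obtain F where F: "F \<in> factorizations M x"
    unfolding atomic_monoid_def by blast
  then have "F \<noteq> {#}"
    using assms(3) by (auto simp: factorizations_def)
  then have "size F \<ge> 1"
    by (simp add: Suc_le_eq nonempty_has_size)
  with F that show thesis by blast
qed

text \<open>Stated for any submonoid containing the powers of a single \<open>q\<close>. The atoms
  of \<open>M\<close> stay unknown; the argument uses only that factorizations exist.\<close>

lemma not_finite_factorization_if_small_powers:
  assumes M: "add_submonoid M" and pow: "\<And>n. q ^ n \<in> M" and q: "0 < q" "q < 1"
  shows "\<not> finite_factorization_monoid M"
proof
  assume ffm: "finite_factorization_monoid M"
  then have atomic: "atomic_monoid M"
    by (simp add: finite_factorization_monoid_def)
  obtain a' b' where ab': "quotient_of q = (a', b')"
    by fastforce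
  \<comment> \<open>Numerator and denominator are taken as naturals, so that
    \<open>a * q ^ n\<close> and \<open>(b - a) * q ^ n\<close> are repeated sums of
    \<open>q ^ n\<close> and hence lie in \<open>M\<close>.\<close>
  define a b where "a = nat a'" and "b = nat b'"
  have "b' > 0" and "q = of_int a' / of_int b'"
    using ab' quotient_of_denom_pos quotient_of_div by blast+
  with q have "a' > 0" "a' < b'"
    by (simp_all add: zero_less_divide_iff)
  then have ab: "0 < a" "a < b" and "of_int a' = (of_nat a :: rat)" "of_int b' = (of_nat b :: rat)"
    by (simp_all add: a_def b_def)
  with \<open>q = _\<close> have bq: "of_nat b * q = of_nat a"
    by simp
  have mult: "of_nat k * q ^ n \<in> M" for k n
    using add_submonoid_of_nat_mult[OF M pow] .
  \<comment> \<open>The partial telescoping sum gains \<open>(b - a) * q ^ Suc n\<close> at each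
    step. This term is nonzero because a < b, so it adds at least one atom.\<close>
  have *: "\<exists>F \<in> factorizations M (of_nat a - of_nat a * q ^ n). n \<le> size F" for n
  proof (induction n)
    case 0
    show ?case by (rule bexI[of _ "{#}"]) (auto simp: factorizations_def)
  next
    case (Suc n)
    then obtain F where F: "F \<in> factorizations M (of_nat a - of_nat a * q ^ n)" "n \<le> size F"
      by blast
    obtain G where G: "G \<in> factorizations M (of_nat (b - a) * q ^ Suc n)" "size G \<ge> 1"
      using ex_nonempty_factorization[OF atomic mult, of "b - a" "Suc n"] ab q by auto
    have "of_nat (b - a) * q ^ Suc n = of_nat b * q * q ^ n - of_nat a * q ^ Suc n"
      using ab by (simp add: of_nat_diff algebra_simps)
    also have "\<dots> = of_nat a * q ^ n - of_nat a * q ^ Suc n"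
      by (simp only: bq)
    finally have "F + G \<in> factorizations M (of_nat a - of_nat a * q ^ Suc n)"
      using factorizations_add[OF F(1) G(1)] by simp
    moreover have "Suc n \<le> size (F + G)"
      using F(2) G(2) by simp
    ultimately show ?case by blast
  qed
  \<comment> \<open>Factoring the remainder \<open>a * q ^ n\<close> as well makes all these long
    multisets factorizations of one fixed element.\<close>
  have long: "\<exists>F \<in> factorizations M (of_nat a). n \<le> size F" for n
  proof -
    obtain F where F: "F \<in> factorizations M (of_nat a - of_nat a * q ^ n)" "n \<le> size F"
      using * by blast
    obtain G where G: "G \<in> factorizations M (of_nat a * q ^ n)"
      using ex_nonempty_factorization[OF atomic mult, of a n] ab q by auto
    have "F + G \<in> factorizations M (of_nat a)"
      using factorizations_add[OF F(1) G] by simp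
    moreover have "n \<le> size (F + G)"
      using F(2) by simp
    ultimately show ?thesis by blast
  qed
  have "of_nat a \<in> M"
    using mult[of a 0] by simp
  then have "finite (size ` factorizations M (of_nat a))"
    using ffm by (simp add: finite_factorization_monoid_def)
  then obtain m where m: "\<forall>k \<in> size ` factorizations M (of_nat a). k \<le> m"
    unfolding finite_nat_set_iff_bounded_le by (rule exE)
  obtain F where "F \<in> factorizations M (of_nat a)" "Suc m \<le> size F"
    using long by blast
  with m have "Suc m \<le> m"
    by (meson imageI order_trans)
  then show False by simp
qed

text \<open>If an element splits into two nonzero parts, each part is at least 1, so the other is
  smaller than the whole by at least 1. Splitting must therefore stop, by induction on a natural
  number strictly above the element.\<close>

lemma atomic_if_bounded_below:
  assumes ge1: "\<And>x. x \<in> M \<Longrightarrow> x \<noteq> 0 \<Longrightarrow> x \<ge> 1"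
  shows "atomic_monoid M"
proof -
  have "factorizations M x \<noteq> {}" if "x \<in> M" "x \<noteq> 0" "x < of_nat n" for x n
    using that
  proof (induction n arbitrary: x)
    case 0
    then show ?case using ge1[of x] by simp
  next
    case (Suc n)
    show ?case
    proof (cases "x \<in> atoms M")
      case True
      then have "{#x#} \<in> factorizations M x"
        by (simp add: factorizations_def)
      then show ?thesis by blast
    next
      case False
      then obtain y z where yz: "y \<in> M" "z \<in> M" "x = y + z" "y \<noteq> 0" "z \<noteq> 0"
        using Suc.prems by (auto simp: atoms_def)
      then have "y < of_nat n" "z < of_nat n"
        using Suc.prems ge1[of y] ge1[of z] by auto
      then have "factorizations M y \<noteq> {}" "factorizations M z \<noteq> {}"
        using yz Suc.IH by blast+
      then show ?thesis
        using factorizations_add yz(3) by blast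
    qed
  qed
  moreover have "\<exists>n. x < of_nat n" for x :: rat
    by (rule reals_Archimedean2)
  ultimately show ?thesis
    unfolding atomic_monoid_def by blast
qed

text \<open>When a sum of two elements is an atom, one summand is 0 and the other is that atom.
  Hence the elements for which being an atom implies lying in \<open>S\<close> form a submonoid
  containing \<open>S\<close>, which is all of \<open>?M\<close>.\<close>

lemma atoms_generated_subset: "atoms (generated_monoid S) \<subseteq> S"
proof -
  let ?M = "generated_monoid S"
  let ?N = "{x \<in> ?M. x \<in> atoms ?M \<longrightarrow> x \<in> S}"
  have M: "0 \<in> ?M" "\<And>x y. x \<in> ?M \<Longrightarrow> y \<in> ?M \<Longrightarrow> x + y \<in> ?M"
    using add_submonoid_generated by (auto simp: add_submonoid_def)
  have "x + y \<in> S" if "x \<in> ?N" "y \<in> ?N" "x + y \<in> atoms ?M" for x y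
  proof -
    have "x = 0 \<or> y = 0"
      using that by (auto simp: atoms_def)
    then show ?thesis using that by auto
  qed
  then have "add_submonoid ?N"
    using M by (auto simp: add_submonoid_def) (simp add: atoms_def)
  then have "?M \<subseteq> ?N"
    using generators_subset by (intro generated_minimal) auto
  then show ?thesis by (auto simp: atoms_def)
qed

lemma size_le_sum_mset:
  fixes F :: "rat multiset"
  assumes "\<And>x. x \<in># F \<Longrightarrow> x \<ge> 1"
  shows "of_nat (size F) \<le> sum_mset F"
  using assms
proof (induction F)
  case (add x F)
  then have "1 \<le> x" "of_nat (size F) \<le> sum_mset F"
    by auto
  then show ?case by simp
qed simp

text \<open>Such multisets are images under \<open>mset\<close> of lists over \<open>A\<close> of
  length at most \<open>n\<close>.\<close>

lemma finite_bounded_multisets: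
  assumes "finite A"
  shows "finite {F. set_mset F \<subseteq> A \<and> size F \<le> n}"
proof (rule finite_subset)
  show "{F. set_mset F \<subseteq> A \<and> size F \<le> n} \<subseteq> mset ` {xs. set xs \<subseteq> A \<and> length xs \<le> n}"
  proof
    fix F assume F: "F \<in> {F. set_mset F \<subseteq> A \<and> size F \<le> n}"
    obtain xs where "mset xs = F" using ex_mset by blast
    with F show "F \<in> mset ` {xs. set xs \<subseteq> A \<and> length xs \<le> n}" by auto
  qed
qed (rule finite_imageI, rule finite_lists_length_le[OF assms])

lemma finite_factorization_generated:
  assumes ge1: "\<And>s. s \<in> S \<Longrightarrow> s \<ge> 1" and fin: "\<And>b. finite {s \<in> S. s \<le> b}"
  shows "finite_factorization_monoid (generated_monoid S)"
proof -
  let ?M = "generated_monoid S"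
  \<comment> \<open>The gap between 0 and 1 survives addition, so it passes from the generators to
    all of \<open>?M\<close>.\<close>
  have "add_submonoid {x. x = 0 \<or> x \<ge> (1 :: rat)}"
    by (auto simp: add_submonoid_def)
  then have "?M \<subseteq> {x. x = 0 \<or> x \<ge> 1}"
    using ge1 by (intro generated_minimal) auto
  then have "atomic_monoid ?M"
    by (intro atomic_if_bounded_below) blast
  moreover have "finite (factorizations ?M b)" for b
  proof -
    obtain n where n: "b < of_nat n" using reals_Archimedean2 by blast
    have "factorizations ?M b \<subseteq> {F. set_mset F \<subseteq> {s \<in> S. s \<le> b} \<and> size F \<le> n}"
    proof
      fix F assume "F \<in> factorizations ?M b"
      then have F: "set_mset F \<subseteq> S" "sum_mset F = b"
        using atoms_generated_subset by (auto simp: factorizations_def)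
      \<comment> \<open>Needed for two submultisets: \<open>F\<close> itself, to bound its size, and
        \<open>F\<close> with one \<open>x\<close> removed, whose sum is then nonnegative, giving x
        \<le> b.\<close>
      have size_le: "of_nat (size G) \<le> sum_mset G" if "G \<subseteq># F" for G
        using F(1) ge1 mset_subset_eqD[OF that] by (intro size_le_sum_mset) blast
      have "x \<le> b" if "x \<in># F" for x
      proof -
        have "0 \<le> (of_nat (size (F - {#x#})) :: rat)"
          by (rule of_nat_0_le_iff)
        also have "\<dots> \<le> sum_mset (F - {#x#})"
          by (rule size_le) (rule diff_subset_eq_self)
        finally have "0 \<le> sum_mset (F - {#x#})" .
        moreover have "sum_mset F = x + sum_mset (F - {#x#})"
          by (metis insert_DiffM sum_mset.add_mset that)
        ultimately show ?thesis using F(2) by simp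
      qed
      moreover have "size F \<le> n"
      proof -
        have "of_nat (size F) < (of_nat n :: rat)"
          using size_le[of F] F(2) n by simp
        then show ?thesis by simp
      qed
      ultimately show "F \<in> {F. set_mset F \<subseteq> {s \<in> S. s \<le> b} \<and> size F \<le> n}"
        using F(1) by auto
    qed
    then show ?thesis
      by (rule finite_subset) (rule finite_bounded_multisets[OF fin])
  qed
  ultimately show ?thesis by (simp add: finite_factorization_monoid_def)
qed

text \<open>The powers of \<open>q\<close> are unbounded and increasing, so every admissible
  exponent lies below the first power found above \<open>b\<close>. That power is obtained in the
  reals and carried back along \<open>of_rat\<close>.\<close>

lemma finite_bounded_powers:
  fixes q b :: rat
  assumes "q > 1"
  shows "finite {n. q ^ n \<le> b}"
proof -
  have "real_of_rat q > 1"
    using assms one_less_of_rat_iff by blast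
  then obtain N where "real_of_rat b < real_of_rat q ^ N"
    using real_arch_pow by blast
  then have "real_of_rat b < real_of_rat (q ^ N)"
    by (simp only: of_rat_power)
  then have N: "b < q ^ N"
    by (simp only: of_rat_less)
  have "n \<le> N" if "q ^ n \<le> b" for n
  proof -
    have "q ^ n < q ^ N" using that N by (rule le_less_trans)
    then have "n < N"
      by (rule power_less_imp_less_exp[OF assms])
    then show ?thesis by simp
  qed
  then show ?thesis
    unfolding finite_nat_set_iff_bounded_le by blast
qed

theorem theorem6p10:
  fixes Q :: "rat set"
  assumes "Q \<subseteq> {q. q > 0} - \<nat>"
    and "finite Q" and "2 \<le> card Q"
    and "Gcd (denominator ` Q) = 1"
  shows "finite_factorization_monoid (powerly_generated_monoid Q) \<longleftrightarrow> (\<forall>q\<in>Q. q \<ge> 1)"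
proof
  assume ffm: "finite_factorization_monoid (powerly_generated_monoid Q)"
  show "\<forall>q\<in>Q. q \<ge> 1"
  proof (rule ccontr)
    assume "\<not> (\<forall>q\<in>Q. q \<ge> 1)"
    then obtain q where q: "q \<in> Q" "q < 1" by force
    have "q ^ n \<in> powerly_generated_monoid Q" for n
      unfolding powerly_generated_monoid_def
      by (rule subsetD[OF generators_subset]) (use q in blast)
    moreover have "q > 0" using q assms(1) by auto
    moreover have "add_submonoid (powerly_generated_monoid Q)"
      unfolding powerly_generated_monoid_def by (rule add_submonoid_generated)
    ultimately show False
      using not_finite_factorization_if_small_powers q(2) ffm by blast
  qed
next
  assume ge1: "\<forall>q\<in>Q. q \<ge> 1"
  have gt1: "q > 1" if "q \<in> Q" for q
  proof -
    \<comment> \<open>Excluding naturals from \<open>Q\<close> rules out 1, whose powers would stay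
      bounded for infinitely many exponents.\<close>
    have "q \<noteq> 1" using that assms(1) by auto
    with ge1 that show ?thesis by force
  qed
  have "finite {s \<in> {q ^ n | q n. q \<in> Q}. s \<le> b}" for b
  proof (rule finite_subset)
    \<comment> \<open>Sorting the generators by base gives a union over the finite set
      \<open>Q\<close>, with finitely many exponents for each base.\<close>
    show "{s \<in> {q ^ n | q n. q \<in> Q}. s \<le> b} \<subseteq> (\<Union>q\<in>Q. (\<lambda>n. q ^ n) ` {n. q ^ n \<le> b})"
      by auto
  qed (use assms(2) gt1 finite_bounded_powers in auto)
  then show "finite_factorization_monoid (powerly_generated_monoid Q)"
    unfolding powerly_generated_monoid_def
    using ge1 by (intro finite_factorization_generated) (auto intro: one_le_power)
qed

end
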